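(* Let $n>1$, $d>1$ be integers. The Bombieri norm on $\mathbb{R}[X_1,\dots,X_n]_d$ is invariant under composition with the orthogonal group: for every $P\in\mathbb{R}[X_1,\dots,X_n]_d$ and every orthogonal transformation $h$ of $\mathbb{R}^n$, $\|P\circ h\|=\|P\|$.
   Context: $\mathbb{R}[X_1,\dots,X_n]_d$ is the space of real homogeneous polynomials of degree $d$ in $n$ variables. The Bombieri scalar product on it is defined by $\langle x^\alpha\mid x^\alpha\rangle=\alpha!/d!$ for multi-indices $\alpha\in\mathbb{N}^n$ with $|\alpha|=d$ (where $\alpha!=\prod_i\alpha_i!$), and $\langle x^\alpha\mid x^\beta\rangle=0$ if $\alpha\ne\beta$; the Bombieri norm is the associated norm. *)

theory Defs
  imports "HOL-Analysis.Analysis" "HOL-Library.Poly_Mapping"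
begin

text \<open>
  Polynomials are elements of the monoid algebra of the multi-indices: finitely supported maps
  from exponents (the additive monoid \<open>'n \<Rightarrow>\<^sub>0 nat\<close>) to coefficients, with
  the convolution product of \<^theory>\<open>HOL-Library.Poly_Mapping\<close>.  The finite type
  \<open>'n\<close> indexes the variables.
\<close>

type_synonym 'n multi_index = "'n \<Rightarrow>\<^sub>0 nat"
type_synonym 'n real_poly = "'n multi_index \<Rightarrow>\<^sub>0 real"

abbreviation coef :: "'n real_poly \<Rightarrow> 'n multi_index \<Rightarrow> real"
  where "coef P \<alpha> \<equiv> Poly_Mapping.lookup P \<alpha>"

abbreviation expo :: "'n multi_index \<Rightarrow> 'n \<Rightarrow> nat"
  where "expo \<alpha> i \<equiv> Poly_Mapping.lookup \<alpha> i"

definition const_poly :: "real \<Rightarrow> 'n real_poly"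
  where "const_poly c = Poly_Mapping.single 0 c"

definition var_poly :: "'n \<Rightarrow> 'n real_poly"
  where "var_poly i = Poly_Mapping.single (Poly_Mapping.single i 1) 1"

definition multi_deg :: "'n::finite multi_index \<Rightarrow> nat"
  where "multi_deg \<alpha> = (\<Sum>i\<in>UNIV. expo \<alpha> i)"

definition multi_fact :: "'n::finite multi_index \<Rightarrow> nat"
  where "multi_fact \<alpha> = (\<Prod>i\<in>UNIV. fact (expo \<alpha> i))"

text \<open>The zero polynomial belongs to every \<open>homog_polys d\<close>, which is a vector space.\<close>

definition homog_polys :: "nat \<Rightarrow> 'n::finite real_poly set"
  where "homog_polys d = {P. \<forall>\<alpha>\<in>Poly_Mapping.keys P. multi_deg \<alpha> = d}"

definition bombieri_monom :: "nat \<Rightarrow> 'n::finite multi_index \<Rightarrow> 'n multi_index \<Rightarrow> real"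
  where "bombieri_monom d \<alpha> \<beta> =
    (if \<alpha> = \<beta> then real (multi_fact \<alpha>) / fact d else 0)"

text \<open>
  The bilinear extension of \<open>bombieri_monom d\<close>.  It is meaningful on
  \<open>homog_polys d\<close> only.
\<close>

definition bombieri_inner :: "nat \<Rightarrow> 'n::finite real_poly \<Rightarrow> 'n real_poly \<Rightarrow> real"
  where "bombieri_inner d P Q =
    (\<Sum>\<alpha>\<in>Poly_Mapping.keys P. \<Sum>\<beta>\<in>Poly_Mapping.keys Q.
       coef P \<alpha> * coef Q \<beta> * bombieri_monom d \<alpha> \<beta>)"

definition bombieri_norm :: "nat \<Rightarrow> 'n::finite real_poly \<Rightarrow> real"
  where "bombieri_norm d P = sqrt (bombieri_inner d P P)"

text \<open>
  For a linear map \<open>h\<close>, the \<open>i\<close>-th coordinate of \<open>h x\<close> is the linear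
  form with coefficients \<open>matrix h $ i $ j\<close>; composing with \<open>h\<close> substitutes
  these forms for the variables.  The lemmas \<open>eval_poly_comp_linear\<close> and
  \<open>poly_comp_linear_homog\<close> below justify this: the result represents the polynomial
  function \<open>P \<circ> h\<close>, and it is again homogeneous of the same degree.
\<close>

definition coord_form :: "(real ^ 'n \<Rightarrow> real ^ 'n) \<Rightarrow> 'n \<Rightarrow> 'n::finite real_poly"
  where "coord_form h i = (\<Sum>j\<in>UNIV. const_poly (matrix h $ i $ j) * var_poly j)"

definition poly_comp_linear ::
    "'n::finite real_poly \<Rightarrow> (real ^ 'n \<Rightarrow> real ^ 'n) \<Rightarrow> 'n real_poly"
  where "poly_comp_linear P h =
    (\<Sum>\<alpha>\<in>Poly_Mapping.keys P.
       const_poly (coef P \<alpha>) * (\<Prod>i\<in>UNIV. coord_form h i ^ expo \<alpha> i))"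

definition eval_poly :: "'n::finite real_poly \<Rightarrow> real ^ 'n \<Rightarrow> real"
  where "eval_poly P x =
    (\<Sum>\<alpha>\<in>Poly_Mapping.keys P. coef P \<alpha> * (\<Prod>i\<in>UNIV. (x $ i) ^ expo \<alpha> i))"

lemma eval_poly_superset:
  assumes "finite S" "Poly_Mapping.keys P \<subseteq> S"
  shows "eval_poly P x = (\<Sum>\<alpha>\<in>S. coef P \<alpha> * (\<Prod>i\<in>UNIV. (x $ i) ^ expo \<alpha> i))"
  unfolding eval_poly_def
  by (rule sum.mono_neutral_left) (use assms in \<open>auto simp: in_keys_iff\<close>)

lemma eval_poly_zero [simp]: "eval_poly 0 x = 0"
  by (simp add: eval_poly_def)

lemma eval_poly_single [simp]:
  "eval_poly (Poly_Mapping.single \<alpha> c) x = c * (\<Prod>i\<in>UNIV. (x $ i) ^ expo \<alpha> i)"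
  by (cases "c = 0") (auto simp: eval_poly_def)

lemma eval_poly_add [simp]: "eval_poly (P + Q) x = eval_poly P x + eval_poly Q x"
proof -
  let ?S = "Poly_Mapping.keys P \<union> Poly_Mapping.keys Q"
  have "Poly_Mapping.keys (P + Q) \<subseteq> ?S" by (rule Poly_Mapping.keys_add)
  then show ?thesis
    by (simp add: eval_poly_superset[of ?S] lookup_add sum.distrib distrib_right)
qed

lemma eval_poly_sum [simp]: "eval_poly (sum f A) x = (\<Sum>a\<in>A. eval_poly (f a) x)"
  by (induction A rule: infinite_finite_induct) auto

lemma real_poly_induct [case_names zero add]:
  fixes P :: "'n real_poly"
  assumes "Q 0" "\<And>\<alpha> c P. Q P \<Longrightarrow> Q (Poly_Mapping.single \<alpha> c + P)"
  shows "Q P"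
proof -
  have *: "Q (\<Sum>\<alpha>\<in>S. Poly_Mapping.single \<alpha> (coef P \<alpha>))" if "finite S" for S
    using that by (induction S) (auto intro: assms)
  have "(\<Sum>\<alpha>\<in>Poly_Mapping.keys P. Poly_Mapping.single \<alpha> (coef P \<alpha>)) = P"
    by (rule poly_mapping_eqI)
      (simp add: lookup_sum lookup_single when_def sum.delta in_keys_iff)
  with *[of "Poly_Mapping.keys P"] show ?thesis by simp
qed

lemma eval_poly_single_mult:
  "eval_poly (Poly_Mapping.single \<alpha> c * Q) x = eval_poly (Poly_Mapping.single \<alpha> c) x * eval_poly Q x"
  by (induction Q rule: real_poly_induct)
    (auto simp: distrib_left mult_single lookup_add power_add prod.distrib algebra_simps)

lemma eval_poly_mult [simp]: "eval_poly (P * Q) x = eval_poly P x * eval_poly Q x"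
  by (induction P rule: real_poly_induct) (auto simp: distrib_right eval_poly_single_mult simp del: eval_poly_single)

lemma eval_poly_one [simp]: "eval_poly 1 x = 1"
  using eval_poly_single[of 0 1 x] by (simp del: eval_poly_single)

lemma eval_poly_power [simp]: "eval_poly (P ^ k) x = eval_poly P x ^ k"
  by (induction k) auto

lemma eval_poly_prod [simp]: "eval_poly (prod f A) x = (\<Prod>a\<in>A. eval_poly (f a) x)"
  by (induction A rule: infinite_finite_induct) auto

lemma eval_const_poly [simp]: "eval_poly (const_poly c) x = c"
  by (simp add: const_poly_def)

lemma eval_var_poly [simp]: "eval_poly (var_poly i) x = x $ i"
proof -
  have "(\<Prod>j\<in>UNIV. (x $ j) ^ expo (Poly_Mapping.single i 1) j) = (\<Prod>j\<in>UNIV. if j = i then x $ j else 1)"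
    by (rule prod.cong) (auto simp: lookup_single when_def)
  then show ?thesis by (simp add: var_poly_def)
qed

lemma eval_coord_form:
  assumes "linear h"
  shows "eval_poly (coord_form h i) x = h x $ i"
proof -
  have "h x = matrix h *v x" using assms by (simp add: matrix_works)
  then show ?thesis by (simp add: coord_form_def matrix_vector_mult_def)
qed

lemma eval_poly_comp_linear:
  assumes "linear h"
  shows "eval_poly (poly_comp_linear P h) = eval_poly P \<circ> h"
  by (rule ext) (simp add: poly_comp_linear_def eval_coord_form[OF assms] eval_poly_def[of P])

lemma homog_polys_zero: "0 \<in> homog_polys d"
  by (simp add: homog_polys_def)

lemma homog_polys_add: "P \<in> homog_polys d \<Longrightarrow> Q \<in> homog_polys d \<Longrightarrow> P + Q \<in> homog_polys d"
  using Poly_Mapping.keys_add[of P Q] by (auto simp: homog_polys_def)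

lemma homog_polys_sum: "(\<And>a. a \<in> A \<Longrightarrow> f a \<in> homog_polys d) \<Longrightarrow> sum f A \<in> homog_polys d"
  by (induction A rule: infinite_finite_induct) (auto intro: homog_polys_add homog_polys_zero)

lemma homog_polys_mult:
  assumes "P \<in> homog_polys d" "Q \<in> homog_polys e"
  shows "P * Q \<in> homog_polys (d + e)"
  using assms keys_mult[of P Q]
  by (fastforce simp: homog_polys_def multi_deg_def lookup_add sum.distrib)

lemma homog_polys_const: "const_poly c \<in> homog_polys 0"
  by (auto simp: homog_polys_def const_poly_def multi_deg_def)

lemma homog_polys_one: "1 \<in> homog_polys 0"
  by (auto simp: homog_polys_def multi_deg_def)

lemma homog_polys_var: "var_poly i \<in> homog_polys 1"
  by (auto simp: homog_polys_def var_poly_def multi_deg_def lookup_single when_def)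

lemma homog_polys_power: "P \<in> homog_polys d \<Longrightarrow> P ^ k \<in> homog_polys (k * d)"
  by (induction k) (auto intro: homog_polys_mult homog_polys_one)

lemma homog_polys_prod:
  "(\<And>a. a \<in> A \<Longrightarrow> f a \<in> homog_polys (g a)) \<Longrightarrow> prod f A \<in> homog_polys (sum g A)"
  by (induction A rule: infinite_finite_induct) (auto intro: homog_polys_mult homog_polys_one)

lemma coord_form_homog: "coord_form h i \<in> homog_polys 1"
  unfolding coord_form_def
  by (rule homog_polys_sum) (use homog_polys_mult[OF homog_polys_const homog_polys_var] in simp)

lemma poly_comp_linear_homog:
  assumes "P \<in> homog_polys d"
  shows "poly_comp_linear P h \<in> homog_polys d"
  unfolding poly_comp_linear_def
proof (rule homog_polys_sum)
  fix \<alpha> assume "\<alpha> \<in> Poly_Mapping.keys P"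
  then have "(\<Sum>i\<in>UNIV. expo \<alpha> i * 1) = d"
    using assms by (simp add: homog_polys_def multi_deg_def)
  then have "(\<Prod>i\<in>UNIV. coord_form h i ^ expo \<alpha> i) \<in> homog_polys d"
    using homog_polys_prod[of UNIV "\<lambda>i. coord_form h i ^ expo \<alpha> i" "\<lambda>i. expo \<alpha> i * 1"]
      homog_polys_power[OF coord_form_homog] by metis
  from homog_polys_mult[OF homog_polys_const this]
  show "const_poly (coef P \<alpha>) * (\<Prod>i\<in>UNIV. coord_form h i ^ expo \<alpha> i) \<in> homog_polys d"
    by simp
qed

end

theory Submission
  imports Defs
begin

text \<open>
  Up to the factor \<open>d!\<close>, the Bombieri product is the Fischer product
  \<open>\<Sum>\<^sub>\<alpha> \<alpha>! p\<^sub>\<alpha> q\<^sub>\<alpha>\<close>, which makes sense on all polynomials and for which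
  multiplication by \<open>x\<^sub>i\<close> is adjoint to \<open>\<partial>\<^sub>i\<close>.  By the chain rule and the
  orthogonality of the rows of \<open>h\<close>, multiplication by the \<open>i\<close>-th coordinate form of \<open>h\<close>
  is adjoint, on polynomials composed with \<open>h\<close>, to \<open>Q \<circ> h \<mapsto> (\<partial>\<^sub>i Q) \<circ> h\<close>.
  Hence composing with \<open>h\<close> preserves the Fischer product, by induction on the first argument.
\<close>

section \<open>Monomials, coefficients, and induction over polynomials\<close>

abbreviation unit_index :: "'n \<Rightarrow> 'n multi_index"
  where "unit_index i \<equiv> Poly_Mapping.single i 1"

lemma multi_index_eq_add_unit:
  fixes \<alpha> :: "'n multi_index"
  assumes "expo \<alpha> i \<noteq> 0"
  obtains \<gamma> where "\<alpha> = \<gamma> + unit_index i"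
proof
  show "\<alpha> = (\<alpha> - unit_index i) + unit_index i"
    by (rule poly_mapping_eqI) (use assms in \<open>auto simp: lookup_add lookup_minus lookup_single when_def\<close>)
qed

lemma const_poly_0 [simp]: "const_poly 0 = 0"
  by (simp add: const_poly_def)

lemma const_poly_add: "const_poly (a + b) = const_poly a + const_poly b"
  by (simp add: const_poly_def single_add)

lemma lookup_const_mult [simp]: "coef (const_poly c * P) \<alpha> = c * coef P \<alpha>"
  by (induction P rule: real_poly_induct)
    (auto simp: const_poly_def distrib_left lookup_add mult_single lookup_single when_def)

lemma var_mult_single:
  "var_poly i * Poly_Mapping.single \<alpha> c = Poly_Mapping.single (\<alpha> + unit_index i) c"
  by (simp add: var_poly_def mult_single add.commute)

lemma lookup_var_mult_add [simp]:
  "coef (var_poly i * P) (\<alpha> + unit_index i) = coef P \<alpha>"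
  by (induction P rule: real_poly_induct)
    (auto simp: distrib_left lookup_add var_mult_single lookup_single when_def)

lemma lookup_var_mult_eq_0:
  assumes "expo \<alpha> i = 0"
  shows "coef (var_poly i * P) \<alpha> = 0"
proof (induction P rule: real_poly_induct)
  case (add \<beta> c P)
  have "\<beta> + unit_index i \<noteq> \<alpha>" using assms by (auto simp: lookup_add)
  with add show ?case by (simp add: distrib_left lookup_add var_mult_single lookup_single)
qed simp

text \<open>Constants and variables generate the polynomial algebra: a monomial is stripped of one
  variable at a time, by induction on its degree. This suits the later rules, which are stated for
  multiplication by one variable.\<close>

lemma real_poly_var_induct [case_names const add var]:
  fixes P :: "'n::finite real_poly"
  assumes const: "\<And>c. R (const_poly c)"
    and add: "\<And>P Q. R P \<Longrightarrow> R Q \<Longrightarrow> R (P + Q)"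
    and var: "\<And>i P. R P \<Longrightarrow> R (var_poly i * P)"
  shows "R P"
proof -
  have single: "R (Poly_Mapping.single \<alpha> c)" for \<alpha> c
  proof (induction "multi_deg \<alpha>" arbitrary: \<alpha> rule: less_induct)
    case less
    show ?case
    proof (cases "\<alpha> = 0")
      case True
      then show ?thesis using const[of c] by (simp add: const_poly_def)
    next
      case False
      then obtain i where "expo \<alpha> i \<noteq> 0" by (metis poly_mapping_eqI lookup_zero)
      then obtain \<gamma> where \<gamma>: "\<alpha> = \<gamma> + unit_index i" by (rule multi_index_eq_add_unit)
      have "multi_deg \<gamma> < multi_deg \<alpha>"
        by (simp add: \<gamma> multi_deg_def lookup_add sum.distrib lookup_single when_def)
      from var[OF less[OF this], of i] show ?thesis by (simp add: \<gamma> var_mult_single)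
    qed
  qed
  show ?thesis
    by (induction P rule: real_poly_induct) (use const[of 0] add single in auto)
qed

subsection \<open>Partial derivatives\<close>

text \<open>Given by coefficients: \<open>x^\<alpha>\<close> in the derivative can only come from
  \<open>x^(\<alpha> + unit_index i)\<close>. The support stays finite because this shift of indices
  is injective.\<close>

lift_definition partial_deriv :: "'n \<Rightarrow> 'n real_poly \<Rightarrow> 'n real_poly"
  is "\<lambda>i p \<alpha>. real (expo \<alpha> i + 1) * p (\<alpha> + unit_index i)"
proof -
  fix i :: 'n and p :: "'n multi_index \<Rightarrow> real"
  assume "finite {\<alpha>. p \<alpha> \<noteq> 0}"
  then have "finite ((\<lambda>\<alpha>. \<alpha> + unit_index i) -` {\<alpha>. p \<alpha> \<noteq> 0})"
    by (rule finite_vimageI) (simp add: inj_on_def)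
  then show "finite {\<alpha>. real (expo \<alpha> i + 1) * p (\<alpha> + unit_index i) \<noteq> 0}"
    by (rule rev_finite_subset) auto
qed

lemma partial_deriv_add: "partial_deriv i (P + Q) = partial_deriv i P + partial_deriv i Q"
  by (rule poly_mapping_eqI) (simp add: partial_deriv.rep_eq lookup_add distrib_left)

lemma partial_deriv_0: "partial_deriv i 0 = 0"
  by (rule poly_mapping_eqI) (simp add: partial_deriv.rep_eq)

lemma partial_deriv_sum: "partial_deriv i (sum f A) = (\<Sum>a\<in>A. partial_deriv i (f a))"
  by (induction A rule: infinite_finite_induct) (auto simp: partial_deriv_add partial_deriv_0)

lemma partial_deriv_const_mult:
  "partial_deriv i (const_poly c * P) = const_poly c * partial_deriv i P"
  by (rule poly_mapping_eqI) (simp add: partial_deriv.rep_eq)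

lemma partial_deriv_const: "partial_deriv i (const_poly c) = 0"
proof (rule poly_mapping_eqI)
  fix \<alpha> :: "'a multi_index"
  have "\<alpha> + unit_index i \<noteq> 0"
    by (metis add_is_0 lookup_add lookup_single_eq lookup_zero one_neq_zero)
  then show "coef (partial_deriv i (const_poly c)) \<alpha> = coef 0 \<alpha>"
    by (auto simp: partial_deriv.rep_eq const_poly_def lookup_single when_def)
qed

text \<open>The Leibniz rule for a product with a variable, checked coefficientwise according to
  whether \<open>x_k\<close> divides \<open>x^\<alpha>\<close>.\<close>

lemma partial_deriv_var_mult:
  "partial_deriv j (var_poly k * P) =
    (if j = k then P else 0) + var_poly k * partial_deriv j P"
proof (rule poly_mapping_eqI)
  fix \<alpha>
  show "coef (partial_deriv j (var_poly k * P)) \<alpha> =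
      coef ((if j = k then P else 0) + var_poly k * partial_deriv j P) \<alpha>"
  proof (cases "expo \<alpha> k = 0")
    case True
    then show ?thesis
      by (cases "j = k")
        (auto simp: partial_deriv.rep_eq lookup_add lookup_var_mult_eq_0 lookup_single when_def
          simp del: One_nat_def)
  next
    case False
    then obtain \<gamma> where \<gamma>: "\<alpha> = \<gamma> + unit_index k" by (rule multi_index_eq_add_unit)
    have "\<alpha> + unit_index j = (\<gamma> + unit_index j) + unit_index k"
      by (simp add: \<gamma> ac_simps)
    then have "coef (partial_deriv j (var_poly k * P)) \<alpha> =
        real (expo \<alpha> j + 1) * coef P (\<gamma> + unit_index j)"
      by (metis lookup_var_mult_add partial_deriv.rep_eq)
    moreover have "coef (var_poly k * partial_deriv j P) \<alpha> =
        real (expo \<gamma> j + 1) * coef P (\<gamma> + unit_index j)"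
      by (simp add: \<gamma> partial_deriv.rep_eq del: One_nat_def)
    \<comment> \<open>For \<open>j = k\<close> the surplus 1 contributes one more copy of
      \<open>coef P \<alpha>\<close>, which is the undifferentiated summand
      \<open>P\<close>.\<close>
    moreover have "expo \<alpha> j = expo \<gamma> j + (if j = k then 1 else 0)"
      by (simp add: \<gamma> lookup_add lookup_single)
    ultimately show ?thesis
      by (cases "j = k") (simp_all add: lookup_add \<gamma> distrib_right del: One_nat_def)
  qed
qed

lemma partial_deriv_coord_form_mult:
  "partial_deriv j (coord_form h k * P) =
    const_poly (matrix h $ k $ j) * P + coord_form h k * partial_deriv j P"
  by (simp add: coord_form_def sum_distrib_right mult.assoc partial_deriv_sum
      partial_deriv_const_mult partial_deriv_var_mult distrib_left sum.distrib
      if_distrib[of "\<lambda>x. _ * x"] cong: if_cong)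

subsection \<open>Linear substitutions\<close>

lemma poly_comp_linear_superset:
  assumes "finite S" "Poly_Mapping.keys P \<subseteq> S"
  shows "poly_comp_linear P h =
    (\<Sum>\<alpha>\<in>S. const_poly (coef P \<alpha>) * (\<Prod>i\<in>UNIV. coord_form h i ^ expo \<alpha> i))"
  unfolding poly_comp_linear_def
  by (rule sum.mono_neutral_left) (use assms in \<open>auto simp: in_keys_iff\<close>)

lemma poly_comp_linear_0: "poly_comp_linear 0 h = 0"
  by (simp add: poly_comp_linear_def)

lemma poly_comp_linear_add:
  "poly_comp_linear (P + Q) h = poly_comp_linear P h + poly_comp_linear Q h"
proof -
  let ?S = "Poly_Mapping.keys P \<union> Poly_Mapping.keys Q"
  have "Poly_Mapping.keys (P + Q) \<subseteq> ?S" by (rule Poly_Mapping.keys_add)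
  then show ?thesis
    by (simp add: poly_comp_linear_superset[of ?S] lookup_add const_poly_add sum.distrib distrib_right)
qed

lemma poly_comp_linear_single:
  "poly_comp_linear (Poly_Mapping.single \<alpha> c) h =
    const_poly c * (\<Prod>i\<in>UNIV. coord_form h i ^ expo \<alpha> i)"
  by (simp add: poly_comp_linear_superset[of "{\<alpha>}"])

lemma poly_comp_linear_const: "poly_comp_linear (const_poly c) h = const_poly c"
  using poly_comp_linear_single[of 0 c h] by (simp add: const_poly_def)

lemma poly_comp_linear_var_mult:
  "poly_comp_linear (var_poly i * P) h = coord_form h i * poly_comp_linear P h"
proof (induction P rule: real_poly_induct)
  case zero
  then show ?case by (simp add: poly_comp_linear_0)
next
  case (add \<alpha> c P)
  have "(\<Prod>j\<in>UNIV. coord_form h j ^ expo (unit_index i) j) =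
      (\<Prod>j\<in>UNIV. if j = i then coord_form h j else 1)"
    by (rule prod.cong) (auto simp: lookup_single when_def)
  then have "(\<Prod>j\<in>UNIV. coord_form h j ^ expo (\<alpha> + unit_index i) j) =
      coord_form h i * (\<Prod>j\<in>UNIV. coord_form h j ^ expo \<alpha> j)"
    by (simp add: lookup_add power_add prod.distrib mult.commute)
  with add show ?case
    by (simp add: distrib_left poly_comp_linear_add var_mult_single poly_comp_linear_single
        mult.left_commute)
qed

text \<open>The chain rule: \<open>matrix h $ k $ j\<close> is the \<open>j\<close>-th partial
  derivative of the \<open>k\<close>-th coordinate form. In the induction both sides obey a Leibniz
  rule.\<close>

lemma partial_deriv_poly_comp_linear:
  "partial_deriv j (poly_comp_linear Q h) =
    (\<Sum>k\<in>UNIV. const_poly (matrix h $ k $ j) * poly_comp_linear (partial_deriv k Q) h)"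
proof (induction Q rule: real_poly_var_induct)
  case (const c)
  then show ?case
    by (simp add: poly_comp_linear_const partial_deriv_const poly_comp_linear_0)
next
  case (add P Q)
  then show ?case
    by (simp add: poly_comp_linear_add partial_deriv_add distrib_left sum.distrib)
next
  case (var m Q)
  \<comment> \<open>The Leibniz term survives only for \<open>k = m\<close>, where it matches the
    derivative of the form \<open>coord_form h m\<close>.\<close>
  have "poly_comp_linear (if k = m then Q else 0) h = (if k = m then poly_comp_linear Q h else 0)"
    for k by (simp add: poly_comp_linear_0)
  with var show ?case
    by (simp add: poly_comp_linear_var_mult partial_deriv_coord_form_mult partial_deriv_var_mult
        poly_comp_linear_add distrib_left sum.distrib sum_distrib_left mult.left_commute
        if_distrib[of "\<lambda>x. _ * x"] cong: if_cong)
qed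

text \<open>Contracting the chain rule with row \<open>i\<close> of the matrix leaves only the
  summand \<open>k = i\<close>, since the rows are orthonormal.\<close>

lemma sum_partial_deriv_poly_comp_orthogonal:
  fixes h :: "real ^ 'n \<Rightarrow> real ^ 'n"
  assumes "orthogonal_transformation h"
  shows "(\<Sum>j\<in>UNIV. const_poly (matrix h $ i $ j) * partial_deriv j (poly_comp_linear Q h)) =
    poly_comp_linear (partial_deriv i Q) h"
proof (rule poly_mapping_eqI)
  fix \<alpha>
  let ?A = "matrix h" and ?q = "\<lambda>k. coef (poly_comp_linear (partial_deriv k Q) h) \<alpha>"
  have "?A ** transpose ?A = mat 1"
    using assms by (auto simp: orthogonal_transformation_matrix orthogonal_matrix_def)
  then have *: "(\<Sum>j\<in>UNIV. ?A $ i $ j * ?A $ k $ j) = (if i = k then 1 else 0)" for k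
    by (auto simp: vec_eq_iff matrix_matrix_mult_def transpose_def mat_def)
  have "(\<Sum>j\<in>UNIV. ?A $ i $ j * (\<Sum>k\<in>UNIV. ?A $ k $ j * ?q k)) =
      (\<Sum>k\<in>UNIV. \<Sum>j\<in>UNIV. ?A $ i $ j * ?A $ k $ j * ?q k)"
    by (subst sum.swap) (simp add: sum_distrib_left mult.assoc)
  also have "\<dots> = (\<Sum>k\<in>UNIV. (if i = k then 1 else 0) * ?q k)"
    by (simp add: * flip: sum_distrib_right)
  also have "\<dots> = ?q i"
    by (simp add: if_distrib[of "\<lambda>x. x * _"] cong: if_cong)
  finally show "coef (\<Sum>j\<in>UNIV. const_poly (?A $ i $ j) * partial_deriv j (poly_comp_linear Q h)) \<alpha> = ?q i"
    by (simp add: lookup_sum partial_deriv_poly_comp_linear)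
qed

text \<open>Coordinate forms have no constant term. This settles the base case of the invariance
  proof.\<close>

lemma coef_0_poly_comp_linear: "coef (poly_comp_linear P h) 0 = coef P 0"
proof (induction P rule: real_poly_var_induct)
  case (var i P)
  then show ?case
    by (simp add: poly_comp_linear_var_mult coord_form_def sum_distrib_right mult.assoc
        lookup_sum lookup_var_mult_eq_0)
qed (simp_all add: poly_comp_linear_const poly_comp_linear_add lookup_add)

subsection \<open>The Fischer product\<close>

text \<open>This is the value at 0 of \<open>P(\<partial>) Q\<close>. Having no degree parameter, it
  allows inductions that leave the homogeneous polynomials of degree \<open>d\<close>.\<close>

definition fischer_inner :: "'n::finite real_poly \<Rightarrow> 'n real_poly \<Rightarrow> real"
  where "fischer_inner P Q =
    (\<Sum>\<alpha>\<in>Poly_Mapping.keys P. real (multi_fact \<alpha>) * coef P \<alpha> * coef Q \<alpha>)"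

lemma fischer_inner_superset:
  assumes "finite S" "Poly_Mapping.keys P \<subseteq> S"
  shows "fischer_inner P Q = (\<Sum>\<alpha>\<in>S. real (multi_fact \<alpha>) * coef P \<alpha> * coef Q \<alpha>)"
  unfolding fischer_inner_def
  by (rule sum.mono_neutral_left) (use assms in \<open>auto simp: in_keys_iff\<close>)

lemma bombieri_inner_eq_fischer_inner: "bombieri_inner d P Q = fischer_inner P Q / fact d"
proof -
  \<comment> \<open>Only \<beta> = \<alpha> contributes; if \<alpha> is not a key of
    \<open>Q\<close>, both sides vanish.\<close>
  have "(\<Sum>\<beta>\<in>Poly_Mapping.keys Q. coef P \<alpha> * coef Q \<beta> * bombieri_monom d \<alpha> \<beta>) =
      real (multi_fact \<alpha>) * coef P \<alpha> * coef Q \<alpha> / fact d" for \<alpha>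
    by (simp add: bombieri_monom_def in_keys_iff if_distrib[of "\<lambda>x. _ * x"] cong: if_cong)
  then show ?thesis
    by (simp add: bombieri_inner_def fischer_inner_def sum_divide_distrib)
qed

lemma fischer_inner_0_left: "fischer_inner 0 Q = 0"
  by (simp add: fischer_inner_def)

lemma fischer_inner_add_left: "fischer_inner (P + P') Q = fischer_inner P Q + fischer_inner P' Q"
proof -
  let ?S = "Poly_Mapping.keys P \<union> Poly_Mapping.keys P'"
  have "Poly_Mapping.keys (P + P') \<subseteq> ?S" by (rule Poly_Mapping.keys_add)
  then show ?thesis
    by (simp add: fischer_inner_superset[of ?S] lookup_add sum.distrib algebra_simps)
qed

lemma fischer_inner_sum_left: "fischer_inner (sum f A) Q = (\<Sum>a\<in>A. fischer_inner (f a) Q)"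
  by (induction A rule: infinite_finite_induct)
    (auto simp: fischer_inner_add_left fischer_inner_0_left)

lemma fischer_inner_sum_right: "fischer_inner P (sum f A) = (\<Sum>a\<in>A. fischer_inner P (f a))"
  unfolding fischer_inner_def lookup_sum sum_distrib_left by (rule sum.swap)

lemma fischer_inner_const_mult_left: "fischer_inner (const_poly c * P) Q = c * fischer_inner P Q"
proof -
  have "Poly_Mapping.keys (const_poly c * P) \<subseteq> Poly_Mapping.keys P"
    by (auto simp: in_keys_iff)
  then show ?thesis
    by (simp add: fischer_inner_superset[of "Poly_Mapping.keys P"] sum_distrib_left mult.assoc mult.left_commute)
qed

lemma fischer_inner_const_mult_right: "fischer_inner P (const_poly c * Q) = c * fischer_inner P Q"
  by (simp add: fischer_inner_def sum_distrib_left mult.assoc mult.left_commute)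

lemma fischer_inner_single_left:
  "fischer_inner (Poly_Mapping.single \<alpha> c) Q = real (multi_fact \<alpha>) * c * coef Q \<alpha>"
  by (simp add: fischer_inner_superset[of "{\<alpha>}"])

lemma fischer_inner_const_left: "fischer_inner (const_poly c) Q = c * coef Q 0"
  by (simp add: const_poly_def fischer_inner_single_left multi_fact_def)

lemma multi_fact_add_unit:
  "multi_fact (\<alpha> + unit_index i) = (expo \<alpha> i + 1) * multi_fact \<alpha>"
proof -
  have "multi_fact (\<alpha> + unit_index i) =
      (\<Prod>j\<in>UNIV. (if j = i then expo \<alpha> i + 1 else 1) * fact (expo \<alpha> j))"
    unfolding multi_fact_def
    by (rule prod.cong) (auto simp: lookup_add lookup_single when_def)
  also have "\<dots> = (expo \<alpha> i + 1) * multi_fact \<alpha>"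
    by (simp add: prod.distrib multi_fact_def)
  finally show ?thesis .
qed

text \<open>On a monomial, \<open>multi_fact (\<alpha> + unit_index i)\<close> supplies exactly the
  factor \<open>expo \<alpha> i + 1\<close> that differentiation produces.\<close>

lemma fischer_inner_var_mult_left:
  "fischer_inner (var_poly i * P) Q = fischer_inner P (partial_deriv i Q)"
  by (induction P rule: real_poly_induct)
    (simp_all add: fischer_inner_0_left distrib_left fischer_inner_add_left var_mult_single
      fischer_inner_single_left multi_fact_add_unit partial_deriv.rep_eq
      del: One_nat_def)

lemma fischer_inner_coord_form_mult_left:
  "fischer_inner (coord_form h i * P) Q =
    fischer_inner P (\<Sum>j\<in>UNIV. const_poly (matrix h $ i $ j) * partial_deriv j Q)"
  by (simp add: coord_form_def sum_distrib_right mult.assoc fischer_inner_sum_left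
      fischer_inner_sum_right fischer_inner_const_mult_left fischer_inner_const_mult_right
      fischer_inner_var_mult_left)

lemma fischer_inner_poly_comp_orthogonal:
  assumes "orthogonal_transformation h"
  shows "fischer_inner (poly_comp_linear P h) (poly_comp_linear Q h) = fischer_inner P Q"
\<comment> \<open>\<open>Q\<close> must vary: moving a coordinate form to the right argument
  replaces \<open>Q\<close> by \<open>partial_deriv i Q\<close> in the \<open>var\<close>
  case.\<close>
proof (induction P arbitrary: Q rule: real_poly_var_induct)
  case (const c)
  then show ?case
    by (simp add: poly_comp_linear_const fischer_inner_const_left coef_0_poly_comp_linear)
next
  case (add P P')
  then show ?case by (simp add: poly_comp_linear_add fischer_inner_add_left)
next
  case (var i P)
  then show ?case
    by (simp add: poly_comp_linear_var_mult fischer_inner_coord_form_mult_left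
        sum_partial_deriv_poly_comp_orthogonal[OF assms] fischer_inner_var_mult_left)
qed

theorem corollary4p3:
  fixes P :: "'n::finite real_poly"
    and h :: "real ^ 'n \<Rightarrow> real ^ 'n"
    and d :: nat
  assumes "CARD('n) > 1"
    and "d > 1"
    and "P \<in> homog_polys d"
    and "orthogonal_transformation h"
  shows "bombieri_norm d (poly_comp_linear P h) = bombieri_norm d P"
  by (simp add: bombieri_norm_def bombieri_inner_eq_fischer_inner
      fischer_inner_poly_comp_orthogonal[OF assms(4)])

end
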